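(* Let $n\ge1$. Every 2-symmetric rational tropical function in $\operatorname{RTrop}[x_{1,1},x_{1,2},\ldots,x_{n,1},x_{n,2}]$ can be written as a rational tropical function in the elementary 2-symmetric tropical polynomials; that is, if $\varepsilon_1,\ldots,\varepsilon_N$ is the list of all elementary 2-symmetric tropical polynomials and $r$ is a 2-symmetric rational tropical function, then there is $R\in\operatorname{RTrop}[y_1,\ldots,y_N]$ such that $r(x)=R(\varepsilon_1(x),\ldots,\varepsilon_N(x))$ for all $x\in\mathbb{R}^{2n}$.
   Context: Tropical arithmetic: $a\oplus b=\min(a,b)$, $a\odot b=a+b$; $b^{-1}$ denotes $-b$, and $x^i$ is the tropical power (ordinary $i\cdot x$). A tropical polynomial expression in given variables is a finite (nonempty) tropical sum of terms $a\odot(\text{monomial})$ with $a\in\mathbb{R}$, where a monomial is a tropical product of integer powers of the variables. A tropical rational expression is a tropical quotient $p\odot q^{-1}$ (ordinary difference $p-q$) of tropical polynomial expressions. $\operatorname{RTrop}[z_1,\ldots,z_M]$, the semiring of rational tropical functions, consists of tropical rational expressions in $z_1,\ldots,z_M$ modulo defining the same function $\mathbb{R}^M\to\mathbb{R}$. A rational tropical function $r\in\operatorname{RTrop}[x_{1,1},x_{1,2},\ldots,x_{n,1},x_{n,2}]$ is 2-symmetric if $r(x_{1,1},x_{1,2},\ldots,x_{n,1},x_{n,2})=r(x_{\pi(1),1},x_{\pi(1),2},\ldots,x_{\pi(n),1},x_{\pi(n),2})$ for all $\pi\in S_n$. Let $\mathscr{E}_n$ be the set of nonzero $n\times2$ matrices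 $E=(e_{i,j})$ with entries in $\{0,1\}$, with $S_n$ acting by permuting rows. For $E\in\mathscr{E}_n$ let $P(E)$ be the tropical product of the variables $x_{i,j}$ with $e_{i,j}=1$. For each orbit $\{E_1,\ldots,E_m\}\in\mathscr{E}_n/S_n$, the tropical polynomial $P(E_1)\oplus\cdots\oplus P(E_m)$ is called an elementary 2-symmetric tropical polynomial. *)

theory Defs
  imports Complex_Main "HOL-Library.FuncSet" "HOL-Combinatorics.Permutations"
begin

text \<open>
  Tropical arithmetic on the reals is written out classically: tropical sum is \<open>min\<close>,
  tropical product is \<open>+\<close>, tropical quotient is \<open>-\<close>, and the tropical power with exponent
  \<open>k\<close> is multiplication by \<open>k\<close>.

  Variables are indexed by a finite set \<open>V\<close>, and a point of \<open>\<real>\<^sup>V\<close> is represented by a total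
  function \<open>x\<close> of which only the values on \<open>V\<close> are ever read. Hence two expressions agree
  on all total functions iff they define the same function on \<open>\<real>\<^sup>V\<close>, and the quotient in the
  definition of rational tropical functions is rendered by taking the functions themselves.
\<close>

definition trop_monomial :: "'v set \<Rightarrow> ('v \<Rightarrow> int) \<Rightarrow> ('v \<Rightarrow> real) \<Rightarrow> real" where
  "trop_monomial V k x = (\<Sum>v\<in>V. of_int (k v) * x v)"

text \<open>
  A tropical polynomial expression is given by the finite nonempty set of its terms, each a
  pair of a real coefficient and an integer exponent vector; repeated terms can be dropped
  because \<open>min\<close> is idempotent.
\<close>

definition trop_poly :: "'v set \<Rightarrow> (real \<times> ('v \<Rightarrow> int)) set \<Rightarrow> ('v \<Rightarrow> real) \<Rightarrow> real" where
  "trop_poly V T x = Min ((\<lambda>(a, k). a + trop_monomial V k x) ` T)"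

definition RTrop :: "'v set \<Rightarrow> (('v \<Rightarrow> real) \<Rightarrow> real) set" where
  "RTrop V = {r. \<exists>S T. finite S \<and> S \<noteq> {} \<and> finite T \<and> T \<noteq> {} \<and>
                      r = (\<lambda>x. trop_poly V S x - trop_poly V T x)}"

text \<open>The pair \<open>(i, j)\<close> stands for the variable \<open>x\<^bsub>i,j\<^esub>\<close>, and equally for a position in an
  \<open>n \<times> 2\<close> matrix.\<close>

definition positions :: "nat \<Rightarrow> (nat \<times> nat) set" where
  "positions n = {1..n} \<times> {1, 2}"

definition permute_rows :: "(nat \<Rightarrow> nat) \<Rightarrow> (nat \<times> nat \<Rightarrow> 'a) \<Rightarrow> nat \<times> nat \<Rightarrow> 'a" where
  "permute_rows \<pi> A = (\<lambda>(i, j). A (\<pi> i, j))"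

definition two_symmetric :: "nat \<Rightarrow> ((nat \<times> nat \<Rightarrow> real) \<Rightarrow> real) \<Rightarrow> bool" where
  "two_symmetric n r \<longleftrightarrow> (\<forall>\<pi>. \<pi> permutes {1..n} \<longrightarrow> (\<forall>x. r x = r (permute_rows \<pi> x)))"

definition binary_matrices :: "nat \<Rightarrow> (nat \<times> nat \<Rightarrow> nat) set" where
  "binary_matrices n = {E \<in> positions n \<rightarrow>\<^sub>E {0, 1}. \<exists>p\<in>positions n. E p \<noteq> 0}"

definition row_orbit :: "nat \<Rightarrow> (nat \<times> nat \<Rightarrow> nat) \<Rightarrow> (nat \<times> nat \<Rightarrow> nat) set" where
  "row_orbit n E = {permute_rows \<pi> E | \<pi>. \<pi> permutes {1..n}}"

definition row_orbits :: "nat \<Rightarrow> (nat \<times> nat \<Rightarrow> nat) set set" where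
  "row_orbits n = row_orbit n ` binary_matrices n"

definition matrix_monomial :: "nat \<Rightarrow> (nat \<times> nat \<Rightarrow> nat) \<Rightarrow> (nat \<times> nat \<Rightarrow> real) \<Rightarrow> real" where
  "matrix_monomial n E x = (\<Sum>p \<in> {p \<in> positions n. E p = 1}. x p)"

definition orbit_poly :: "nat \<Rightarrow> (nat \<times> nat \<Rightarrow> nat) set \<Rightarrow> (nat \<times> nat \<Rightarrow> real) \<Rightarrow> real" where
  "orbit_poly n Q x = Min ((\<lambda>E. matrix_monomial n E x) ` Q)"

definition elementary_two_symmetric :: "nat \<Rightarrow> ((nat \<times> nat \<Rightarrow> real) \<Rightarrow> real) set" where
  "elementary_two_symmetric n = orbit_poly n ` row_orbits n"

end

theory Submission imports Defs begin

text \<open>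
  Let \<open>C\<close> be the set of functions of the form \<open>R(\<epsilon>\<^sub>1, \<dots>, \<epsilon>\<^sub>N)\<close>; it contains the constants and is closed
  under difference, minimum and substitution into rational tropical functions. The sum of the \<open>k\<close>
  smallest entries of a column is elementary, so the order statistics \<open>u\<^sub>i\<close> and \<open>v\<^sub>i\<close> of the two
  columns lie in \<open>C\<close>. For a permutation \<open>\<tau>\<close> let \<open>x\<^sub>\<tau>\<close> be the matrix with rows \<open>(u\<^sub>i, v\<^bsub>\<tau> i\<^esub>)\<close>; for every \<open>x\<close>
  some \<open>x\<^sub>\<tau>\<close> is a row permutation of \<open>x\<close>. The claim follows from
  \<open>r(x) = max\<^sub>\<tau> (r(x\<^sub>\<tau>) - K * (\<Sum>\<^sub>k \<bar>\<epsilon>\<^sub>k(x) - \<epsilon>\<^sub>k(x\<^sub>\<tau>)\<bar>))\<close> for large \<open>K\<close>. As \<open>r\<close> is symmetric and Lipschitz,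
  this only needs a quantitative separation of orbits: if all \<open>\<epsilon>\<^sub>k\<close> differ by at most \<open>\<eta>\<close> at \<open>x\<close> and \<open>y\<close>,
  then the rows of \<open>x\<close> and \<open>y\<close> can be matched with errors at most a constant times \<open>\<eta>\<close>.

  For the separation, regard the rows as points \<open>(s, t)\<close> of the plane. The \<open>\<epsilon>\<^sub>k\<close> determine
  \<open>\<Sum>\<^sub>i min(0, s\<^sub>i - a, t\<^sub>i - c)\<close> for all \<open>a\<close> and \<open>c\<close>, hence also the sums over the points of the functions
  \<open>max(0, a - s - max(0, c - t))\<close>. Testing these at a point that maximises \<open>t - 2 s\<close> over both
  configurations produces a nearby point of the other one; remove the pair and induct.
\<close>

subsection \<open>Closure properties of rational tropical functions\<close>

text \<open>Tropical distributivity: a product of two tropical sums expands into all pairwise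
  products.\<close>

lemma Min_sum_Times:
  fixes f :: "'a \<Rightarrow> real" and g :: "'b \<Rightarrow> real"
  assumes "finite S" "S \<noteq> {}" "finite T" "T \<noteq> {}"
  shows "Min ((\<lambda>(s, t). f s + g t) ` (S \<times> T)) = Min (f ` S) + Min (g ` T)"
proof (rule Min_eqI)
  show "finite ((\<lambda>(s, t). f s + g t) ` (S \<times> T))"
    using assms by simp
  show "Min (f ` S) + Min (g ` T) \<le> y" if "y \<in> (\<lambda>(s, t). f s + g t) ` (S \<times> T)" for y
    using that assms by (auto intro!: add_mono)
  have "Min (f ` S) \<in> f ` S" "Min (g ` T) \<in> g ` T"
    using assms by (auto intro!: Min_in)
  then obtain s t where "s \<in> S" "t \<in> T" "Min (f ` S) = f s" "Min (g ` T) = g t"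
    by blast
  then show "Min (f ` S) + Min (g ` T) \<in> (\<lambda>(s, t). f s + g t) ` (S \<times> T)"
    by force
qed

text \<open>Abstract because three classes are instances: \<open>RTrop V\<close>, the compositions
  \<open>R (\<lambda>v. \<epsilon> v x)\<close>, and the Lipschitz functions.\<close>

locale trop_closed =
  fixes F :: "('a \<Rightarrow> real) set"
  assumes const: "(\<lambda>_. c) \<in> F"
    and diff: "f \<in> F \<Longrightarrow> g \<in> F \<Longrightarrow> (\<lambda>x. f x - g x) \<in> F"
    and min: "f \<in> F \<Longrightarrow> g \<in> F \<Longrightarrow> (\<lambda>x. min (f x) (g x)) \<in> F"
begin

lemma uminus: "f \<in> F \<Longrightarrow> (\<lambda>x. - f x) \<in> F"
  using diff[OF const[of 0]] by simp

lemma add: "f \<in> F \<Longrightarrow> g \<in> F \<Longrightarrow> (\<lambda>x. f x + g x) \<in> F"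
  using diff[OF _ uminus, of f g] by simp

lemma max:
  assumes "f \<in> F" "g \<in> F"
  shows "(\<lambda>x. max (f x) (g x)) \<in> F"
proof -
  have "(\<lambda>x. max (f x) (g x)) = (\<lambda>x. - min (- f x) (- g x))"
    by (auto simp: fun_eq_iff max_def min_def)
  then show ?thesis
    using uminus[OF min[OF uminus uminus]] assms by simp
qed

lemma abs:
  assumes "f \<in> F"
  shows "(\<lambda>x. \<bar>f x\<bar>) \<in> F"
proof -
  have "(\<lambda>x. \<bar>f x\<bar>) = (\<lambda>x. max (f x) (- f x))"
    by (auto simp: fun_eq_iff)
  then show ?thesis
    using max[OF assms uminus[OF assms]] by simp
qed

lemma sum: "(\<And>i. i \<in> I \<Longrightarrow> f i \<in> F) \<Longrightarrow> (\<lambda>x. \<Sum>i\<in>I. f i x) \<in> F"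
  by (induction I rule: infinite_finite_induct) (auto intro: const add)

lemma Min:
  assumes "finite I" "I \<noteq> {}" "\<And>i. i \<in> I \<Longrightarrow> f i \<in> F"
  shows "(\<lambda>x. Min ((\<lambda>i. f i x) ` I)) \<in> F"
  using assms by (induction I rule: finite_ne_induct) (auto intro: min)

lemma Max:
  assumes "finite I" "I \<noteq> {}" "\<And>i. i \<in> I \<Longrightarrow> f i \<in> F"
  shows "(\<lambda>x. Max ((\<lambda>i. f i x) ` I)) \<in> F"
  using assms by (induction I rule: finite_ne_induct) (auto intro: max)

lemma of_nat_mult: "f \<in> F \<Longrightarrow> (\<lambda>x. of_nat m * f x) \<in> F"
  using sum[of "{..<m}" "\<lambda>_. f"] by simp

lemma of_int_mult: "f \<in> F \<Longrightarrow> (\<lambda>x. of_int k * f x) \<in> F"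
  using of_nat_mult[of f] uminus[OF of_nat_mult[of f]]
  by (cases k rule: int_cases2) auto

lemma comp_trop_poly:
  assumes "finite S" "S \<noteq> {}" "\<And>v. v \<in> V \<Longrightarrow> g v \<in> F"
  shows "(\<lambda>x. trop_poly V S (\<lambda>v. g v x)) \<in> F"
  unfolding trop_poly_def trop_monomial_def
  using assms by (intro Min) (auto intro!: add const sum of_int_mult)

text \<open>With the coordinates for \<open>g\<close> this is an induction principle: a closed class
  containing them contains \<open>RTrop V\<close>.\<close>

lemma comp_RTrop:
  assumes "R \<in> RTrop V" "\<And>v. v \<in> V \<Longrightarrow> g v \<in> F"
  shows "(\<lambda>x. R (\<lambda>v. g v x)) \<in> F"
  using assms by (auto simp: RTrop_def intro!: diff comp_trop_poly)

end

section \<open>Tropical sums and products of polynomial expressions\<close>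

lemma trop_poly_min:
  assumes "finite S" "S \<noteq> {}" "finite T" "T \<noteq> {}"
  shows "trop_poly V (S \<union> T) x = min (trop_poly V S x) (trop_poly V T x)"
  unfolding trop_poly_def image_Un using assms by (intro Min_Un) auto

definition terms_mult ::
    "(real \<times> ('v \<Rightarrow> int)) set \<Rightarrow> (real \<times> ('v \<Rightarrow> int)) set \<Rightarrow> (real \<times> ('v \<Rightarrow> int)) set" where
  "terms_mult S T = (\<lambda>((a, k), (b, l)). (a + b, \<lambda>v. k v + l v)) ` (S \<times> T)"

lemma finite_terms_mult: "finite S \<Longrightarrow> finite T \<Longrightarrow> finite (terms_mult S T)"
  by (simp add: terms_mult_def)

lemma terms_mult_nonempty: "S \<noteq> {} \<Longrightarrow> T \<noteq> {} \<Longrightarrow> terms_mult S T \<noteq> {}"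
  by (simp add: terms_mult_def)

lemma trop_poly_terms_mult:
  assumes "finite S" "S \<noteq> {}" "finite T" "T \<noteq> {}"
  shows "trop_poly V (terms_mult S T) x = trop_poly V S x + trop_poly V T x"
  unfolding trop_poly_def terms_mult_def image_image Min_sum_Times[OF assms, symmetric]
  by (rule arg_cong[where f = Min], rule image_cong)
    (auto simp: trop_monomial_def sum.distrib algebra_simps)

lemma RTropI:
  "finite S \<Longrightarrow> S \<noteq> {} \<Longrightarrow> finite T \<Longrightarrow> T \<noteq> {} \<Longrightarrow>
    (\<lambda>x. trop_poly V S x - trop_poly V T x) \<in> RTrop V"
  unfolding RTrop_def by blast

interpretation RTrop: trop_closed "RTrop V" for V
proof
  fix c :: real
  show "(\<lambda>_. c) \<in> RTrop V"
    unfolding RTrop_def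
    by (intro CollectI exI[of _ "{(c, \<lambda>_. 0)}"] exI[of _ "{(0, \<lambda>_. 0)}"])
      (simp add: trop_poly_def trop_monomial_def)
next
  fix f g assume "f \<in> RTrop V" "g \<in> RTrop V"
  then obtain S T S' T'
    where S: "finite S" "S \<noteq> {}" and T: "finite T" "T \<noteq> {}"
      and f: "f = (\<lambda>x. trop_poly V S x - trop_poly V T x)"
      and S': "finite S'" "S' \<noteq> {}" and T': "finite T'" "T' \<noteq> {}"
      and g: "g = (\<lambda>x. trop_poly V S' x - trop_poly V T' x)"
    unfolding RTrop_def by blast
  note fin = S T S' T' finite_terms_mult terms_mult_nonempty
  have "(\<lambda>x. f x - g x) =
      (\<lambda>x. trop_poly V (terms_mult S T') x - trop_poly V (terms_mult T S') x)"
    by (simp add: f g trop_poly_terms_mult fin fun_eq_iff)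
  then show "(\<lambda>x. f x - g x) \<in> RTrop V"
    by (simp add: RTropI fin)
  \<comment> \<open>Common denominator:
    \<open>min (p - q) (p' - q') = min (p + q') (p' + q) - (q + q')\<close>.\<close>
  have "(\<lambda>x. min (f x) (g x)) =
      (\<lambda>x. trop_poly V (terms_mult S T' \<union> terms_mult S' T) x - trop_poly V (terms_mult T T') x)"
    by (auto simp: f g trop_poly_terms_mult trop_poly_min fin min_def fun_eq_iff)
  then show "(\<lambda>x. min (f x) (g x)) \<in> RTrop V"
    by (simp add: RTropI fin)
qed

lemma proj_RTrop:
  assumes "finite V" "v \<in> V"
  shows "(\<lambda>x. x v) \<in> RTrop V"
proof -
  have "(\<lambda>x. x v) =
      (\<lambda>x. trop_poly V {(0, \<lambda>w. if w = v then 1 else 0)} x - trop_poly V {(0, \<lambda>_. 0)} x)"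
    using assms by (simp add: trop_poly_def trop_monomial_def if_distrib[of of_int]
        if_distrib[of "\<lambda>a. a * _"] cong: if_cong)
  then show ?thesis
    using RTropI[of "{_}" "{_}"] by simp
qed

lemma trop_closed_comp:
  "trop_closed {f. \<exists>R\<in>RTrop V. \<forall>x. f x = R (\<lambda>v. \<epsilon> v x)}"
proof
  fix c :: real
  show "(\<lambda>_. c) \<in> {f. \<exists>R\<in>RTrop V. \<forall>x. f x = R (\<lambda>v. \<epsilon> v x)}"
    using RTrop.const by force
next
  fix f g
  assume "f \<in> {f. \<exists>R\<in>RTrop V. \<forall>x. f x = R (\<lambda>v. \<epsilon> v x)}"
    "g \<in> {f. \<exists>R\<in>RTrop V. \<forall>x. f x = R (\<lambda>v. \<epsilon> v x)}"
  then obtain R R' where R: "R \<in> RTrop V" "R' \<in> RTrop V"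
      "\<forall>x. f x = R (\<lambda>v. \<epsilon> v x)" "\<forall>x. g x = R' (\<lambda>v. \<epsilon> v x)"
    by blast
  show "(\<lambda>x. f x - g x) \<in> {f. \<exists>R\<in>RTrop V. \<forall>x. f x = R (\<lambda>v. \<epsilon> v x)}"
    using RTrop.diff[OF R(1,2)] R(3,4) by force
  show "(\<lambda>x. min (f x) (g x)) \<in> {f. \<exists>R\<in>RTrop V. \<forall>x. f x = R (\<lambda>v. \<epsilon> v x)}"
    using RTrop.min[OF R(1,2)] R(3,4) by force
qed

text \<open>Phrased with a bound \<delta>, so that no maximum over a possibly empty or infinite
  \<open>V\<close> has to be formed.\<close>

definition sup_lipschitz :: "'v set \<Rightarrow> (('v \<Rightarrow> real) \<Rightarrow> real) \<Rightarrow> bool" where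
  "sup_lipschitz V f \<longleftrightarrow> (\<exists>L\<ge>0. \<forall>\<delta> x y. (\<forall>v\<in>V. \<bar>x v - y v\<bar> \<le> \<delta>) \<longrightarrow> 0 \<le> \<delta> \<longrightarrow> \<bar>f x - f y\<bar> \<le> L * \<delta>)"

lemma trop_closed_lipschitz: "trop_closed {f. sup_lipschitz V f}"
proof
  fix c :: real
  show "(\<lambda>_. c) \<in> {f. sup_lipschitz V f}"
    by (auto simp: sup_lipschitz_def)
next
  fix f g assume "f \<in> {f. sup_lipschitz V f}" "g \<in> {f. sup_lipschitz V f}"
  then obtain L M where L: "L \<ge> 0"
      "\<And>\<delta> x y. \<forall>v\<in>V. \<bar>x v - y v\<bar> \<le> \<delta> \<Longrightarrow> 0 \<le> \<delta> \<Longrightarrow> \<bar>f x - f y\<bar> \<le> L * \<delta>"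
    and M: "M \<ge> 0"
      "\<And>\<delta> x y. \<forall>v\<in>V. \<bar>x v - y v\<bar> \<le> \<delta> \<Longrightarrow> 0 \<le> \<delta> \<Longrightarrow> \<bar>g x - g y\<bar> \<le> M * \<delta>"
    unfolding sup_lipschitz_def mem_Collect_eq by metis
  have *: "\<bar>f x - f y\<bar> \<le> L * \<delta>" "\<bar>g x - g y\<bar> \<le> M * \<delta>" "0 \<le> L * \<delta>" "0 \<le> M * \<delta>"
    if "\<forall>v\<in>V. \<bar>x v - y v\<bar> \<le> \<delta>" "0 \<le> \<delta>" for \<delta> x y
    using L M that by auto
  show "(\<lambda>x. f x - g x) \<in> {f. sup_lipschitz V f}"
    unfolding sup_lipschitz_def mem_Collect_eq
  proof (intro exI[of _ "L + M"] conjI allI impI)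
    fix \<delta> :: real and x y assume "\<forall>v\<in>V. \<bar>x v - y v\<bar> \<le> \<delta>" "0 \<le> \<delta>"
    from *[OF this] show "\<bar>(f x - g x) - (f y - g y)\<bar> \<le> (L + M) * \<delta>"
      by (simp add: distrib_right)
  qed (use L M in simp)
  show "(\<lambda>x. min (f x) (g x)) \<in> {f. sup_lipschitz V f}"
    unfolding sup_lipschitz_def mem_Collect_eq
  proof (intro exI[of _ "L + M"] conjI allI impI)
    fix \<delta> :: real and x y assume "\<forall>v\<in>V. \<bar>x v - y v\<bar> \<le> \<delta>" "0 \<le> \<delta>"
    from *[OF this] show "\<bar>min (f x) (g x) - min (f y) (g y)\<bar> \<le> (L + M) * \<delta>"
      by (simp add: distrib_right)
  qed (use L M in simp)
qed

lemma RTrop_lipschitz: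
  assumes "r \<in> RTrop V"
  shows "sup_lipschitz V r"
proof -
  interpret trop_closed "{f. sup_lipschitz V f}"
    by (rule trop_closed_lipschitz)
  have "(\<lambda>x. x v) \<in> {f. sup_lipschitz V f}" if "v \<in> V" for v
    using that by (auto simp: sup_lipschitz_def intro!: exI[of _ 1])
  from comp_RTrop[OF assms this] show ?thesis
    by simp
qed

subsection \<open>Matching planar points\<close>

definition hat :: "real \<Rightarrow> real \<Rightarrow> real \<Rightarrow> real \<Rightarrow> real" where
  "hat a c s t = max 0 (a - s - max 0 (c - t))"

lemma hat_nonneg: "0 \<le> hat a c s t"
  by (simp add: hat_def)

lemma hat_lipschitz:
  "\<bar>s - s'\<bar> \<le> \<delta> \<Longrightarrow> \<bar>t - t'\<bar> \<le> \<delta> \<Longrightarrow> \<bar>hat a c s t - hat a c s' t'\<bar> \<le> 2 * \<delta>"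
  unfolding hat_def by linarith

text \<open>The subtrahend is a tropical line at \<open>(s, t)\<close>, the minuend the same line
  without its \<open>s\<close> term.\<close>

lemma hat_eq_min: "hat a c s t = min 0 (t - c) - min 0 (min (s - a) (t - c))"
  unfolding hat_def by linarith

text \<open>With \<open>a = s p + 2 * \<eta>\<close> and \<open>c = t p\<close> the point \<open>p\<close> contributes \<open>2 * \<eta>\<close>, so some point of \<open>B\<close>
  contributes too; the tilted extremality keeps that point from being far up or far to the left.\<close>

lemma ex_partner:
  fixes s t :: "'a \<Rightarrow> real" and s' t' :: "'b \<Rightarrow> real"
  assumes "finite A" "p \<in> A" "0 < \<eta>"
    and close: "\<And>a c. \<bar>(\<Sum>i\<in>A. hat a c (s i) (t i)) - (\<Sum>j\<in>B. hat a c (s' j) (t' j))\<bar> \<le> \<eta>"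
    and extremal: "\<And>j. j \<in> B \<Longrightarrow> t' j - 2 * s' j \<le> t p - 2 * s p"
  obtains j where "j \<in> B" "\<bar>s p - s' j\<bar> \<le> 4 * \<eta>" "\<bar>t p - t' j\<bar> \<le> 4 * \<eta>"
proof -
  let ?a = "s p + 2 * \<eta>" and ?c = "t p"
  have "2 * \<eta> = hat ?a ?c (s p) (t p)"
    using \<open>0 < \<eta>\<close> by (simp add: hat_def)
  also have "\<dots> \<le> (\<Sum>i\<in>A. hat ?a ?c (s i) (t i))"
    using assms by (intro member_le_sum hat_nonneg) auto
  also have "\<dots> \<le> (\<Sum>j\<in>B. hat ?a ?c (s' j) (t' j)) + \<eta>"
    using close[of ?a ?c] by linarith
  finally have "(\<Sum>j\<in>B. hat ?a ?c (s' j) (t' j)) > 0"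
    using \<open>0 < \<eta>\<close> by linarith
  then obtain j where j: "j \<in> B" "hat ?a ?c (s' j) (t' j) > 0"
    by (meson linorder_not_less sum_nonpos)
  show thesis
  proof (rule that[OF j(1)])
    \<comment> \<open>Relative to \<open>p\<close>, the point \<open>j\<close> lies in the triangle
      with vertices \<open>(-2\<eta>, -4\<eta>)\<close>, \<open>(2\<eta>, 0)\<close>,
      \<open>(2\<eta>, 4\<eta>)\<close>: the extremality line of slope 2 cuts off the wedge where
      the hat is positive, whose edges are vertical and of slope 1.\<close>
    show "\<bar>s p - s' j\<bar> \<le> 4 * \<eta>" "\<bar>t p - t' j\<bar> \<le> 4 * \<eta>"
      using j(2) extremal[OF j(1)] unfolding hat_def by linarith+
  qed
qed

lemma ex_maximizer:
  fixes f :: "'a \<Rightarrow> real"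
  assumes "finite A" "A \<noteq> {}"
  shows "\<exists>p\<in>A. \<forall>i\<in>A. f i \<le> f p"
proof -
  have "Max (f ` A) \<in> f ` A"
    using assms by (intro Max_in) auto
  then obtain p where "p \<in> A" "Max (f ` A) = f p"
    by blast
  then show ?thesis
    using assms Max_ge[of "f ` A"] by (intro bexI[of _ p]) auto
qed

text \<open>Each round matches one pair within 4 times the current error and then multiplies that
  error by 9. The index sets are arbitrary because the removed indices may differ.\<close>

lemma ex_matching:
  fixes s t :: "'a \<Rightarrow> real" and s' t' :: "'b \<Rightarrow> real"
  assumes "finite A" "finite B" "card A = m" "card B = m" "0 < \<eta>"
    and "\<And>a c. \<bar>(\<Sum>i\<in>A. hat a c (s i) (t i)) - (\<Sum>j\<in>B. hat a c (s' j) (t' j))\<bar> \<le> \<eta>"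
  shows "\<exists>\<pi>. bij_betw \<pi> A B \<and>
    (\<forall>i\<in>A. \<bar>s i - s' (\<pi> i)\<bar> \<le> 4 * 9 ^ m * \<eta> \<and> \<bar>t i - t' (\<pi> i)\<bar> \<le> 4 * 9 ^ m * \<eta>)"
  using assms
proof (induction m arbitrary: A B \<eta>)
  case 0
  then show ?case
    by (auto simp: bij_betw_def)
next
  case (Suc m)
  note close = Suc.prems(6)
  have ne: "A \<noteq> {}" "B \<noteq> {}"
    using Suc.prems(3,4) by auto
  obtain p where p: "p \<in> A" "\<And>i. i \<in> A \<Longrightarrow> t i - 2 * s i \<le> t p - 2 * s p"
    using ex_maximizer[OF Suc.prems(1) ne(1), of "\<lambda>i. t i - 2 * s i"] by blast
  obtain q where q: "q \<in> B" "\<And>j. j \<in> B \<Longrightarrow> t' j - 2 * s' j \<le> t' q - 2 * s' q"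
    using ex_maximizer[OF Suc.prems(2) ne(2), of "\<lambda>j. t' j - 2 * s' j"] by blast
  \<comment> \<open>The better of the two maximisers is extremal for both configurations; in the
    second case \<open>A\<close> and \<open>B\<close> exchange roles.\<close>
  have "\<exists>i\<in>A. \<exists>j\<in>B. \<bar>s i - s' j\<bar> \<le> 4 * \<eta> \<and> \<bar>t i - t' j\<bar> \<le> 4 * \<eta>"
  proof (cases "t' q - 2 * s' q \<le> t p - 2 * s p")
    case True
    then have "t' j - 2 * s' j \<le> t p - 2 * s p" if "j \<in> B" for j
      using q(2)[OF that] by linarith
    from ex_partner[OF Suc.prems(1) p(1) \<open>0 < \<eta>\<close> close this]
    show ?thesis
      using p(1) by metis
  next
    case False
    then have ext: "t i - 2 * s i \<le> t' q - 2 * s' q" if "i \<in> A" for i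
      using p(2)[OF that] by linarith
    have "\<bar>(\<Sum>j\<in>B. hat a c (s' j) (t' j)) - (\<Sum>i\<in>A. hat a c (s i) (t i))\<bar> \<le> \<eta>" for a c
      using close[of a c] by linarith
    from ex_partner[OF Suc.prems(2) q(1) \<open>0 < \<eta>\<close> this ext]
    show ?thesis
      using q(1) by (metis abs_minus_commute)
  qed
  then obtain i j where ij: "i \<in> A" "j \<in> B" "\<bar>s i - s' j\<bar> \<le> 4 * \<eta>" "\<bar>t i - t' j\<bar> \<le> 4 * \<eta>"
    by blast
  have "finite (A - {i})" "finite (B - {j})" "card (A - {i}) = m" "card (B - {j}) = m" "0 < 9 * \<eta>"
    using Suc.prems(1-5) ij by auto
  \<comment> \<open>The removed summands differ by at most \<open>2 * (4 * \<eta>)\<close>; the old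
    error adds one more \<eta>.\<close>
  moreover have "\<bar>(\<Sum>i\<in>A - {i}. hat a c (s i) (t i)) - (\<Sum>j\<in>B - {j}. hat a c (s' j) (t' j))\<bar> \<le> 9 * \<eta>"
    for a c
    using close[of a c] hat_lipschitz[OF ij(3,4), of a c]
      sum.remove[OF Suc.prems(1) ij(1), of "\<lambda>i. hat a c (s i) (t i)"]
      sum.remove[OF Suc.prems(2) ij(2), of "\<lambda>j. hat a c (s' j) (t' j)"]
    by linarith
  ultimately obtain \<pi> where \<pi>: "bij_betw \<pi> (A - {i}) (B - {j})"
      "\<forall>k\<in>A - {i}. \<bar>s k - s' (\<pi> k)\<bar> \<le> 4 * 9 ^ m * (9 * \<eta>) \<and> \<bar>t k - t' (\<pi> k)\<bar> \<le> 4 * 9 ^ m * (9 * \<eta>)"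
    using Suc.IH[of "A - {i}" "B - {j}" "9 * \<eta>"] by blast
  let ?\<pi> = "\<pi>(i := j)"
  have "bij_betw ?\<pi> (A - {i}) (B - {j})"
    using \<pi>(1) by (subst bij_betw_cong[of _ _ \<pi>]) auto
  moreover have "bij_betw ?\<pi> {i} {j}"
    by (simp add: bij_betw_def)
  ultimately have "bij_betw ?\<pi> ((A - {i}) \<union> {i}) ((B - {j}) \<union> {j})"
    by (rule bij_betw_combine) auto
  then have "bij_betw ?\<pi> A B"
    using ij by (simp add: insert_absorb)
  moreover have "4 * \<eta> \<le> 4 * 9 ^ Suc m * \<eta>"
    using \<open>0 < \<eta>\<close> one_le_power[of "9::real" "Suc m"] by simp
  then have "\<forall>k\<in>A. \<bar>s k - s' (?\<pi> k)\<bar> \<le> 4 * 9 ^ Suc m * \<eta> \<and> \<bar>t k - t' (?\<pi> k)\<bar> \<le> 4 * 9 ^ Suc m * \<eta>"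
    using \<pi>(2) ij(3,4) by (auto simp: mult_ac)
  ultimately show ?case
    by blast
qed

subsection \<open>Elementary 2-symmetric tropical polynomials\<close>

declare One_nat_def [simp del]

section \<open>Row orbits and invariance under row permutations\<close>

lemma finite_positions: "finite (positions n)"
  by (simp add: positions_def)

lemma permute_rows_apply [simp]: "permute_rows \<pi> A (i, j) = A (\<pi> i, j)"
  by (simp add: permute_rows_def)

lemma permute_rows_permute_rows: "permute_rows \<pi> (permute_rows \<rho> A) = permute_rows (\<rho> \<circ> \<pi>) A"
  by (auto simp: permute_rows_def)

lemma permute_rows_id [simp]: "permute_rows id A = A"
  by (auto simp: permute_rows_def)

lemma row_orbit_altdef: "row_orbit n E = (\<lambda>\<pi>. permute_rows \<pi> E) ` {\<pi>. \<pi> permutes {1..n}}"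
  by (auto simp: row_orbit_def)

lemma finite_row_orbit: "finite (row_orbit n E)"
  by (simp add: row_orbit_altdef finite_permutations)

lemma row_orbit_self: "E \<in> row_orbit n E"
  unfolding row_orbit_altdef by (rule image_eqI[of _ _ id]) (auto intro: permutes_id)

lemma row_orbit_permute:
  assumes "E' \<in> row_orbit n E" "\<pi> permutes {1..n}"
  shows "permute_rows \<pi> E' \<in> row_orbit n E"
  using assms by (auto simp: row_orbit_def permute_rows_permute_rows intro: permutes_compose)

lemma matrix_monomial_rows:
  "matrix_monomial n E x =
    (\<Sum>i\<in>{1..n}. (if E (i, 1) = 1 then x (i, 1) else 0) + (if E (i, 2) = 1 then x (i, 2) else 0))"
proof -
  have "matrix_monomial n E x = (\<Sum>p\<in>positions n. if E p = 1 then x p else 0)"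
    by (simp add: matrix_monomial_def sum.inter_filter finite_positions)
  also have "\<dots> = (\<Sum>i\<in>{1..n}. \<Sum>j\<in>{1, 2}. if E (i, j) = 1 then x (i, j) else 0)"
    unfolding positions_def sum.cartesian_product by (rule sum.cong) auto
  finally show ?thesis
    by simp
qed

lemma matrix_monomial_permute:
  assumes "\<pi> permutes {1..n}"
  shows "matrix_monomial n (permute_rows \<pi> E) (permute_rows \<pi> x) = matrix_monomial n E x"
  unfolding matrix_monomial_rows permute_rows_apply
  using sum.permute[OF assms, of "\<lambda>i. (if E (i, 1) = 1 then x (i, 1) else 0) +
      (if E (i, 2) = 1 then x (i, 2) else 0)"]
  by (simp add: comp_def)

lemma orbit_poly_RTrop: "orbit_poly n (row_orbit n E) \<in> RTrop (positions n)"
  unfolding orbit_poly_def[abs_def] matrix_monomial_def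
  using finite_row_orbit row_orbit_self[of E n] finite_positions
  by (intro RTrop.Min RTrop.sum proj_RTrop) auto

lemma orbit_poly_le:
  assumes "E' \<in> row_orbit n E"
  shows "orbit_poly n (row_orbit n E) x \<le> matrix_monomial n E' x"
  unfolding orbit_poly_def using assms by (intro Min_le) (auto simp: finite_row_orbit)

lemma orbit_poly_attained:
  obtains E' where "E' \<in> row_orbit n E" "orbit_poly n (row_orbit n E) x = matrix_monomial n E' x"
proof -
  have "orbit_poly n (row_orbit n E) x \<in> (\<lambda>E. matrix_monomial n E x) ` row_orbit n E"
    unfolding orbit_poly_def using row_orbit_self[of E n]
    by (intro Min_in) (auto simp: finite_row_orbit)
  then show thesis
    using that by blast
qed

text \<open>A minimising matrix, permuted along with \<open>x\<close>, stays in the orbit and keeps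
  its value.\<close>

lemma orbit_poly_permute_le:
  assumes "\<pi> permutes {1..n}"
  shows "orbit_poly n (row_orbit n E) (permute_rows \<pi> x) \<le> orbit_poly n (row_orbit n E) x"
proof -
  obtain E' where "E' \<in> row_orbit n E" "orbit_poly n (row_orbit n E) x = matrix_monomial n E' x"
    by (rule orbit_poly_attained)
  then show ?thesis
    using orbit_poly_le[OF row_orbit_permute[OF _ assms], of E' E "permute_rows \<pi> x"]
      matrix_monomial_permute[OF assms, of E' x] by simp
qed

lemma orbit_poly_permute:
  assumes "\<pi> permutes {1..n}"
  shows "orbit_poly n (row_orbit n E) (permute_rows \<pi> x) = orbit_poly n (row_orbit n E) x"
proof (rule antisym[OF orbit_poly_permute_le[OF assms]])
  show "orbit_poly n (row_orbit n E) x \<le> orbit_poly n (row_orbit n E) (permute_rows \<pi> x)"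
    using orbit_poly_permute_le[OF permutes_inv[OF assms], of E "permute_rows \<pi> x"]
    by (simp add: permute_rows_permute_rows permutes_inv_o[OF assms])
qed

section \<open>Products of tropical lines and the separation of orbits\<close>

definition trop_line_sum :: "nat \<Rightarrow> real \<Rightarrow> real \<Rightarrow> (nat \<times> nat \<Rightarrow> real) \<Rightarrow> real" where
  "trop_line_sum n a c x = (\<Sum>i\<in>{1..n}. min 0 (min (x (i, 1) - a) (x (i, 2) - c)))"

text \<open>A product of tropical lines, expanded, is a tropical combination of orbit polynomials of
  matrices with at most one entry 1 in each row.\<close>

lemma trop_line_sum_le:
  assumes close: "\<And>E. E \<in> binary_matrices n \<Longrightarrow>
      orbit_poly n (row_orbit n E) x \<le> orbit_poly n (row_orbit n E) y + \<eta>"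
    and "0 \<le> \<eta>"
  shows "trop_line_sum n a c x \<le> trop_line_sum n a c y + \<eta>"
proof -
  \<comment> \<open>All rows of \<open>w\<close> are equal, so shifting by \<open>w\<close> changes
    every monomial of an orbit by the same amount.\<close>
  define w :: "nat \<times> nat \<Rightarrow> real" where "w = (\<lambda>(i, j). if j = 1 then a else c)"
  \<comment> \<open>\<open>E\<close> marks in each row a term attaining the minimum at
    \<open>y\<close>, and nothing if 0 is strictly smallest. The mix of \<le> and \<open><\<close>
    breaks ties, so that no row has two ones.\<close>
  define E :: "nat \<times> nat \<Rightarrow> nat" where "E = restrict (\<lambda>(i, j).
    if j = 1 then of_bool (y (i, 1) - a \<le> y (i, 2) - c \<and> y (i, 1) - a \<le> 0)
    else of_bool (y (i, 2) - c < y (i, 1) - a \<and> y (i, 2) - c \<le> 0)) (positions n)"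
  have mono_diff: "matrix_monomial n E' (\<lambda>p. z p - w p) = matrix_monomial n E' z - matrix_monomial n E' w"
    for E' z
    by (simp add: matrix_monomial_def sum_subtractf)
  have E_rows: "E (i, 1) = of_bool (y (i, 1) - a \<le> y (i, 2) - c \<and> y (i, 1) - a \<le> 0)"
    "E (i, 2) = of_bool (y (i, 2) - c < y (i, 1) - a \<and> y (i, 2) - c \<le> 0)" if "i \<in> {1..n}" for i
    using that by (auto simp: E_def positions_def)
  have y: "trop_line_sum n a c y = matrix_monomial n E (\<lambda>p. y p - w p)"
    unfolding trop_line_sum_def matrix_monomial_rows
    by (rule sum.cong) (auto simp: E_rows w_def)
  show ?thesis
  proof (cases "E \<in> binary_matrices n")
    case True
    obtain E' where E': "E' \<in> row_orbit n E"
        "orbit_poly n (row_orbit n E) x = matrix_monomial n E' x"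
      by (rule orbit_poly_attained)
    then obtain \<pi> where \<pi>: "\<pi> permutes {1..n}" "E' = permute_rows \<pi> E"
      by (auto simp: row_orbit_def)
    have "permute_rows \<pi> w = w"
      by (auto simp: w_def permute_rows_def)
    then have w: "matrix_monomial n E' w = matrix_monomial n E w"
      using matrix_monomial_permute[OF \<pi>(1), of E w] \<pi>(2) by simp
    \<comment> \<open>With at most one 1 per row, \<open>E'\<close> selects in each row one of the
      three terms of the line, which is at least their minimum.\<close>
    have "trop_line_sum n a c x \<le> matrix_monomial n E' (\<lambda>p. x p - w p)"
      unfolding trop_line_sum_def matrix_monomial_rows
    proof (rule sum_mono)
      fix i assume "i \<in> {1..n}"
      then have "\<pi> i \<in> {1..n}"
        using \<pi>(1) by (simp only: permutes_in_image)
      from E_rows[OF this] have "\<not> (E' (i, 1) = 1 \<and> E' (i, 2) = 1)"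
        by (auto simp: \<pi>(2))
      then show "min 0 (min (x (i, 1) - a) (x (i, 2) - c)) \<le>
          (if E' (i, 1) = 1 then x (i, 1) - w (i, 1) else 0) +
          (if E' (i, 2) = 1 then x (i, 2) - w (i, 2) else 0)"
        by (auto simp: w_def)
    qed
    also have "\<dots> = orbit_poly n (row_orbit n E) x - matrix_monomial n E w"
      by (simp add: mono_diff w E')
    also have "\<dots> \<le> orbit_poly n (row_orbit n E) y - matrix_monomial n E w + \<eta>"
      using close[OF True] by simp
    also have "\<dots> \<le> matrix_monomial n E y - matrix_monomial n E w + \<eta>"
      using orbit_poly_le[OF row_orbit_self, of n E y] by simp
    also have "\<dots> = trop_line_sum n a c y + \<eta>"
      by (simp add: y mono_diff)
    finally show ?thesis .
  next
    \<comment> \<open>Here \<open>E\<close> is the zero matrix: the value at \<open>y\<close> is 0,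
      the largest value possible.\<close>
    case False
    moreover have "E \<in> positions n \<rightarrow>\<^sub>E {0, 1}"
      by (auto simp: E_def)
    ultimately have "\<forall>p\<in>positions n. E p = 0"
      by (auto simp: binary_matrices_def)
    then have "trop_line_sum n a c y = 0"
      unfolding y matrix_monomial_def by (intro sum.neutral) auto
    moreover have "trop_line_sum n a c x \<le> 0"
      unfolding trop_line_sum_def by (intro sum_nonpos) simp
    ultimately show ?thesis
      using \<open>0 \<le> \<eta>\<close> by simp
  qed
qed

text \<open>By \<open>hat_eq_min\<close> a hat sum is a difference of two line sums, each known up
  to \<eta>; hence the factor 2.\<close>

lemma hat_sum_close:
  assumes "\<And>E. E \<in> binary_matrices n \<Longrightarrow>
      \<bar>orbit_poly n (row_orbit n E) x - orbit_poly n (row_orbit n E) y\<bar> \<le> \<eta>"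
    and "0 \<le> \<eta>"
  shows "\<bar>(\<Sum>i\<in>{1..n}. hat a c (x (i, 1)) (x (i, 2))) - (\<Sum>i\<in>{1..n}. hat a c (y (i, 1)) (y (i, 2)))\<bar>
    \<le> 2 * \<eta>"
proof -
  \<comment> \<open>The first coordinates drop out of \<open>trop_line_sum n b c\<close>; the index 0 only keeps the set nonempty.\<close>
  define b where "b = Min ((\<lambda>i. min (x (i, 1)) (y (i, 1))) ` {0..n})"
  have b: "b \<le> x (i, 1)" "b \<le> y (i, 1)" if "i \<in> {1..n}" for i
  proof -
    have "b \<le> min (x (i, 1)) (y (i, 1))"
      unfolding b_def using that by (intro Min_le) auto
    then show "b \<le> x (i, 1)" "b \<le> y (i, 1)"
      by auto
  qed
  have close: "\<bar>trop_line_sum n d c x - trop_line_sum n d c y\<bar> \<le> \<eta>" for d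
    using trop_line_sum_le[of n x y \<eta> d c] trop_line_sum_le[of n y x \<eta> d c] assms
    by (smt (verit))
  have *: "(\<Sum>i\<in>{1..n}. hat a c (z (i, 1)) (z (i, 2))) = trop_line_sum n b c z - trop_line_sum n a c z"
    if "\<And>i. i \<in> {1..n} \<Longrightarrow> b \<le> z (i, 1)" for z
    unfolding trop_line_sum_def sum_subtractf[symmetric]
  proof (rule sum.cong)
    fix i assume "i \<in> {1..n}"
    from that[OF this] show "hat a c (z (i, 1)) (z (i, 2)) =
        min 0 (min (z (i, 1) - b) (z (i, 2) - c)) - min 0 (min (z (i, 1) - a) (z (i, 2) - c))"
      unfolding hat_eq_min by linarith
  qed simp
  show ?thesis
    using *[of x, OF b(1)] *[of y, OF b(2)] close[of a] close[of b] by linarith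
qed

text \<open>\<open>ex_matching\<close> applied to the hat sums with error \<open>2 * \<eta>\<close>,
  whence the factor 8.\<close>

lemma orbit_polys_separate:
  assumes "\<And>E. E \<in> binary_matrices n \<Longrightarrow>
      \<bar>orbit_poly n (row_orbit n E) x - orbit_poly n (row_orbit n E) y\<bar> \<le> \<eta>"
    and "0 < \<eta>"
  obtains \<pi> where "\<pi> permutes {1..n}"
    "\<And>p. p \<in> positions n \<Longrightarrow> \<bar>x p - permute_rows \<pi> y p\<bar> \<le> 8 * 9 ^ n * \<eta>"
proof -
  have "\<exists>\<pi>. bij_betw \<pi> {1..n} {1..n} \<and>
    (\<forall>i\<in>{1..n}. \<bar>x (i, 1) - y (\<pi> i, 1)\<bar> \<le> 4 * 9 ^ n * (2 * \<eta>) \<and>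
      \<bar>x (i, 2) - y (\<pi> i, 2)\<bar> \<le> 4 * 9 ^ n * (2 * \<eta>))"
    using hat_sum_close[OF assms(1)] \<open>0 < \<eta>\<close> by (intro ex_matching) auto
  then obtain \<pi> where \<pi>: "bij_betw \<pi> {1..n} {1..n}"
    "\<And>i. i \<in> {1..n} \<Longrightarrow> \<bar>x (i, 1) - y (\<pi> i, 1)\<bar> \<le> 8 * 9 ^ n * \<eta> \<and>
      \<bar>x (i, 2) - y (\<pi> i, 2)\<bar> \<le> 8 * 9 ^ n * \<eta>"
    by (auto simp: mult_ac)
  define \<rho> where "\<rho> i = (if i \<in> {1..n} then \<pi> i else i)" for i
  have "bij_betw \<rho> {1..n} {1..n}"
    using \<pi>(1) by (rule bij_betw_cong[THEN iffD1, rotated]) (simp add: \<rho>_def)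
  then have "\<rho> permutes {1..n}"
    by (rule bij_imp_permutes) (auto simp: \<rho>_def)
  then show thesis
    by (rule that) (use \<pi>(2) in \<open>auto simp: positions_def \<rho>_def\<close>)
qed

subsection \<open>Order statistics of the columns\<close>

lemma ex_sorting_permutation:
  fixes w :: "nat \<Rightarrow> real"
  obtains \<sigma> where "\<sigma> permutes {1..n}" "mono_on {1..n} (w \<circ> \<sigma>)"
proof -
  define xs where "xs = sort_key w [1..<Suc n]"
  \<comment> \<open>Lists count from 0, ranks from 1; \<open>permutes\<close> demands the identity
    outside \<open>{1..n}\<close>.\<close>
  define \<sigma> where "\<sigma> i = (if i \<in> {1..n} then xs ! (i - 1) else i)" for i
  have len: "length xs = n" and set: "set xs = {1..n}" and "distinct xs"
    by (auto simp: xs_def)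
  have "bij_betw (\<lambda>i. i - 1) {1..n} {..<n}"
    by (rule bij_betw_byWitness[where f' = Suc]) auto
  moreover have "bij_betw ((!) xs) {..<n} {1..n}"
    using bij_betw_nth[OF \<open>distinct xs\<close>] len set by blast
  ultimately have "bij_betw ((!) xs \<circ> (\<lambda>i. i - 1)) {1..n} {1..n}"
    by (rule bij_betw_trans)
  then have "bij_betw \<sigma> {1..n} {1..n}"
    by (rule bij_betw_cong[THEN iffD1, rotated]) (simp add: \<sigma>_def)
  then have "\<sigma> permutes {1..n}"
    by (rule bij_imp_permutes) (auto simp: \<sigma>_def)
  moreover have "mono_on {1..n} (w \<circ> \<sigma>)"
  proof (rule mono_onI)
    fix i j assume ij: "i \<in> {1..n}" "j \<in> {1..n}" "i \<le> j"
    have "sorted (map w xs)"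
      by (simp add: xs_def)
    from sorted_nth_mono[OF this, of "i - 1" "j - 1"] show "(w \<circ> \<sigma>) i \<le> (w \<circ> \<sigma>) j"
      using ij len by (simp add: \<sigma>_def)
  qed
  ultimately show thesis
    by (rule that)
qed

text \<open>Subtract \<open>u k\<close> from all terms: those of index at most \<open>k\<close>
  become nonpositive, the others nonnegative. Both sums have \<open>k\<close> terms, so the shift
  cancels.\<close>

lemma sum_initial_segment_le:
  fixes u :: "nat \<Rightarrow> real"
  assumes mono: "mono_on {1..n} u" and k: "k \<in> {1..n}"
    and f: "inj_on f {1..k}" "f ` {1..k} \<subseteq> {1..n}"
  shows "(\<Sum>i\<in>{1..k}. u i) \<le> (\<Sum>i\<in>{1..k}. u (f i))"
proof -
  let ?A = "f ` {1..k}"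
  have "(\<Sum>i\<in>{1..k}. u i - u k) \<le> (\<Sum>i\<in>?A \<inter> {1..k}. u i - u k)"
  proof -
    have "(\<Sum>i\<in>{1..k} - ?A. u i - u k) \<le> 0"
      using k by (intro sum_nonpos) (auto intro!: mono_onD[OF mono])
    then show ?thesis
      using sum.subset_diff[of "?A \<inter> {1..k}" "{1..k}" "\<lambda>i. u i - u k"]
      by (simp add: Diff_Int)
  qed
  also have "\<dots> \<le> (\<Sum>i\<in>?A. u i - u k)"
    using f(2) k by (intro sum_mono2) (auto intro!: mono_onD[OF mono])
  also have "\<dots> = (\<Sum>i\<in>{1..k}. u (f i) - u k)"
    using f(1) by (simp add: sum.reindex)
  finally show ?thesis
    by (simp add: sum_subtractf)
qed

text \<open>For \<open>k\<close> at most \<open>n\<close> the orbit polynomial of this matrix is the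
  \<open>k\<close>-th elementary symmetric tropical polynomial of column \<open>j\<close>.\<close>

definition column_matrix :: "nat \<Rightarrow> nat \<Rightarrow> nat \<Rightarrow> nat \<times> nat \<Rightarrow> nat" where
  "column_matrix n j k = restrict (\<lambda>(i, j'). of_bool (j' = j \<and> i \<le> k)) (positions n)"

lemma column_matrix_binary:
  assumes "k \<in> {1..n}" "j \<in> {1, 2}"
  shows "column_matrix n j k \<in> binary_matrices n"
proof -
  have "column_matrix n j k (1, j) \<noteq> 0" "(1, j) \<in> positions n"
    using assms by (auto simp: column_matrix_def positions_def)
  moreover have "column_matrix n j k \<in> positions n \<rightarrow>\<^sub>E {0, 1}"
    by (auto simp: column_matrix_def)
  ultimately show ?thesis
    unfolding binary_matrices_def by blast
qed

lemma matrix_monomial_column: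
  assumes "k \<in> {1..n}" "j \<in> {1, 2}" "\<pi> permutes {1..n}"
  shows "matrix_monomial n (permute_rows (inv \<pi>) (column_matrix n j k)) x = (\<Sum>i\<in>{1..k}. x (\<pi> i, j))"
proof -
  have "matrix_monomial n (permute_rows (inv \<pi>) (column_matrix n j k)) x
      = matrix_monomial n (column_matrix n j k) (permute_rows \<pi> x)"
    using matrix_monomial_permute[OF permutes_inv[OF assms(3)], of "column_matrix n j k" "permute_rows \<pi> x"]
    by (simp add: permute_rows_permute_rows permutes_inv_o[OF assms(3)])
  also have "\<dots> = (\<Sum>i\<in>{1..n}. if i \<le> k then x (\<pi> i, j) else 0)"
    unfolding matrix_monomial_rows
    by (rule sum.cong) (use assms(2) in \<open>auto simp: column_matrix_def positions_def\<close>)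
  also have "\<dots> = (\<Sum>i\<in>{1..k}. x (\<pi> i, j))"
    using assms(1) by (intro sum.mono_neutral_cong_right) auto
  finally show ?thesis .
qed

lemma orbit_poly_column:
  assumes k: "k \<in> {1..n}" and j: "j \<in> {1, 2}" and \<sigma>: "\<sigma> permutes {1..n}"
    and mono: "mono_on {1..n} (\<lambda>i. x (\<sigma> i, j))"
  shows "orbit_poly n (row_orbit n (column_matrix n j k)) x = (\<Sum>i\<in>{1..k}. x (\<sigma> i, j))"
proof (rule antisym)
  have "permute_rows (inv \<sigma>) (column_matrix n j k) \<in> row_orbit n (column_matrix n j k)"
    by (intro row_orbit_permute row_orbit_self permutes_inv \<sigma>)
  from orbit_poly_le[OF this, of x]
  show "orbit_poly n (row_orbit n (column_matrix n j k)) x \<le> (\<Sum>i\<in>{1..k}. x (\<sigma> i, j))"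
    by (simp only: matrix_monomial_column[OF k j \<sigma>])
next
  obtain \<rho> where \<rho>: "\<rho> permutes {1..n}"
      "orbit_poly n (row_orbit n (column_matrix n j k)) x =
        matrix_monomial n (permute_rows \<rho> (column_matrix n j k)) x"
    by (rule orbit_poly_attained) (auto simp: row_orbit_def)
  define \<pi> where "\<pi> = inv \<rho>"
  have \<pi>: "\<pi> permutes {1..n}" "inv \<pi> = \<rho>"
    using \<rho>(1) by (auto simp: \<pi>_def permutes_inv permutes_inv_inv)
  \<comment> \<open>This sends \<open>i\<close> to the rank of row \<open>\<pi> i\<close> in the
    sorted column.\<close>
  have f: "inv \<sigma> \<circ> \<pi> permutes {1..n}"
    by (intro permutes_compose permutes_inv \<sigma> \<pi>)
  have "(\<Sum>i\<in>{1..k}. x (\<sigma> i, j)) \<le> (\<Sum>i\<in>{1..k}. x (\<sigma> ((inv \<sigma> \<circ> \<pi>) i), j))"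
  proof (rule sum_initial_segment_le[OF mono k])
    show "inj_on (inv \<sigma> \<circ> \<pi>) {1..k}"
      using permutes_inj[OF f] by (rule inj_on_subset) simp
    have "{1..k} \<subseteq> {1..n}"
      using k by auto
    from image_mono[OF this] show "(inv \<sigma> \<circ> \<pi>) ` {1..k} \<subseteq> {1..n}"
      by (metis permutes_image[OF f])
  qed
  also have "\<dots> = (\<Sum>i\<in>{1..k}. x (\<pi> i, j))"
    by (simp add: permutes_inverses[OF \<sigma>])
  also have "\<dots> = orbit_poly n (row_orbit n (column_matrix n j k)) x"
    using matrix_monomial_column[OF k j \<pi>(1), of x] \<rho>(2) \<pi>(2) by simp
  finally show "(\<Sum>i\<in>{1..k}. x (\<sigma> i, j)) \<le> orbit_poly n (row_orbit n (column_matrix n j k)) x" .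
qed

text \<open>The case \<open>k = 1\<close> is separate because \<open>column_matrix n j 0\<close> is
  the zero matrix, which yields no elementary polynomial.\<close>

definition order_statistic :: "nat \<Rightarrow> nat \<Rightarrow> nat \<Rightarrow> (nat \<times> nat \<Rightarrow> real) \<Rightarrow> real" where
  "order_statistic n j k x = orbit_poly n (row_orbit n (column_matrix n j k)) x -
     (if k = 1 then 0 else orbit_poly n (row_orbit n (column_matrix n j (k - 1))) x)"

lemma order_statistic_eq:
  assumes k: "k \<in> {1..n}" and j: "j \<in> {1, 2}" and \<sigma>: "\<sigma> permutes {1..n}"
    and mono: "mono_on {1..n} (\<lambda>i. x (\<sigma> i, j))"
  shows "order_statistic n j k x = x (\<sigma> k, j)"
proof (cases "k = 1")
  case True
  then show ?thesis
    using orbit_poly_column[OF assms] by (simp add: order_statistic_def)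
next
  case False
  then obtain m where m: "k = Suc m" "m \<in> {1..n}"
    using k by (cases k) auto
  then show ?thesis
    using orbit_poly_column[OF assms] orbit_poly_column[OF m(2) j \<sigma> mono] False
    by (simp add: order_statistic_def)
qed

definition rearrange :: "nat \<Rightarrow> (nat \<Rightarrow> nat) \<Rightarrow> (nat \<times> nat \<Rightarrow> real) \<Rightarrow> nat \<times> nat \<Rightarrow> real" where
  "rearrange n \<tau> x = (\<lambda>(i, j). order_statistic n j (if j = 1 then i else \<tau> i) x)"

lemma ex_rearrange_eq:
  obtains \<tau> \<sigma> where "\<tau> permutes {1..n}" "\<sigma> permutes {1..n}"
    "\<And>p. p \<in> positions n \<Longrightarrow> rearrange n \<tau> x p = permute_rows \<sigma> x p"
proof -
  obtain \<sigma> where \<sigma>: "\<sigma> permutes {1..n}" "mono_on {1..n} (\<lambda>i. x (\<sigma> i, 1))"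
    using ex_sorting_permutation[of n "\<lambda>i. x (i, 1)"] by (auto simp: comp_def)
  obtain \<sigma>' where \<sigma>': "\<sigma>' permutes {1..n}" "mono_on {1..n} (\<lambda>i. x (\<sigma>' i, 2))"
    using ex_sorting_permutation[of n "\<lambda>i. x (i, 2)"] by (auto simp: comp_def)
  \<comment> \<open>This sends the rank of a row in the first column to its rank in the
    second.\<close>
  have \<tau>: "inv \<sigma>' \<circ> \<sigma> permutes {1..n}"
    by (intro permutes_compose permutes_inv \<sigma> \<sigma>')
  show thesis
  proof (rule that[OF \<tau> \<sigma>(1)])
    fix p assume "p \<in> positions n"
    then obtain i j where p: "p = (i, j)" "i \<in> {1..n}" "j \<in> {1, 2}"
      by (auto simp: positions_def)
    have "(inv \<sigma>' \<circ> \<sigma>) i \<in> {1..n}"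
      using p(2) by (simp only: permutes_in_image[OF \<tau>])
    then show "rearrange n (inv \<sigma>' \<circ> \<sigma>) x p = permute_rows \<sigma> x p"
      using order_statistic_eq[OF p(2) _ \<sigma>] order_statistic_eq[OF _ _ \<sigma>', of "(inv \<sigma>' \<circ> \<sigma>) i"] p(3)
      by (auto simp: rearrange_def p(1) permutes_inverses[OF \<sigma>'(1)])
  qed
qed

subsection \<open>The representation\<close>

lemma trop_poly_cong: "(\<And>v. v \<in> V \<Longrightarrow> x v = y v) \<Longrightarrow> trop_poly V S x = trop_poly V S y"
  by (simp add: trop_poly_def trop_monomial_def)

lemma RTrop_cong: "r \<in> RTrop V \<Longrightarrow> (\<And>v. v \<in> V \<Longrightarrow> x v = y v) \<Longrightarrow> r x = r y"
  using trop_poly_cong[of V x y] by (auto simp: RTrop_def)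

theorem theorem6p2:
  fixes n N :: nat
    and r :: "(nat \<times> nat \<Rightarrow> real) \<Rightarrow> real"
    and \<epsilon> :: "nat \<Rightarrow> (nat \<times> nat \<Rightarrow> real) \<Rightarrow> real"
  assumes "n \<ge> 1"
    and "bij_betw \<epsilon> {1..N} (elementary_two_symmetric n)"
    and "r \<in> RTrop (positions n)"
    and "two_symmetric n r"
  shows "\<exists>R \<in> RTrop {1..N}. \<forall>x. r x = R (\<lambda>k. \<epsilon> k x)"
proof -
  define C where "C = {f. \<exists>R\<in>RTrop {1..N}. \<forall>x. f x = R (\<lambda>k. \<epsilon> k x)}"
  interpret C: trop_closed C
    unfolding C_def by (rule trop_closed_comp)
  have sym: "r (permute_rows \<pi> x) = r x" if "\<pi> permutes {1..n}" for \<pi> x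
    using assms(4) that unfolding two_symmetric_def by metis
  have \<epsilon>_C: "\<epsilon> k \<in> C" if "k \<in> {1..N}" for k
    using proj_RTrop[OF _ that] by (force simp: C_def)
  have \<epsilon>_orbit: "\<exists>E\<in>binary_matrices n. \<epsilon> k = orbit_poly n (row_orbit n E)" if "k \<in> {1..N}" for k
    using bij_betwE[OF assms(2)] that
    by (auto simp: elementary_two_symmetric_def row_orbits_def)
  have orbit_\<epsilon>: "\<exists>k\<in>{1..N}. orbit_poly n (row_orbit n E) = \<epsilon> k" if "E \<in> binary_matrices n" for E
  proof -
    have "orbit_poly n (row_orbit n E) \<in> \<epsilon> ` {1..N}"
      unfolding bij_betw_imp_surj_on[OF assms(2)] elementary_two_symmetric_def row_orbits_def
      using that by blast
    then show ?thesis
      by blast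
  qed
  have \<epsilon>_RTrop: "\<epsilon> k \<in> RTrop (positions n)" if "k \<in> {1..N}" for k
    using \<epsilon>_orbit[OF that] orbit_poly_RTrop by metis
  have \<epsilon>_sym: "\<epsilon> k (permute_rows \<pi> x) = \<epsilon> k x" if "k \<in> {1..N}" "\<pi> permutes {1..n}" for k \<pi> x
    using \<epsilon>_orbit[OF that(1)] orbit_poly_permute[OF that(2)] by metis
  have "order_statistic n j k \<in> C" if "k \<in> {1..n}" "j \<in> {1, 2}" for j k
  proof -
    have orb: "orbit_poly n (row_orbit n (column_matrix n j m)) \<in> C" if "m \<in> {1..n}" for m
      using orbit_\<epsilon>[OF column_matrix_binary[OF that \<open>j \<in> {1, 2}\<close>]] \<epsilon>_C by metis
    show ?thesis
    proof (cases "k = 1")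
      case True
      then show ?thesis
        using orb[OF that(1)] C.diff[OF orb[OF that(1)] C.const[of 0]]
        by (simp add: order_statistic_def[abs_def])
    next
      case False
      then have "k - 1 \<in> {1..n}"
        using that by auto
      from C.diff[OF orb[OF that(1)] orb[OF this]] show ?thesis
        using False by (simp add: order_statistic_def[abs_def])
    qed
  qed
  then have rearrange_C: "(\<lambda>x. rearrange n \<tau> x p) \<in> C" if "\<tau> permutes {1..n}" "p \<in> positions n" for \<tau> p
    using that permutes_in_image[OF that(1), of "fst p"]
    unfolding rearrange_def positions_def by (cases p) auto
  \<comment> \<open>This needs nothing about symmetry of \<open>f\<close>: the coordinates of
    \<open>rearrange n \<tau> x\<close> already lie in \<open>C\<close>.\<close>
  have comp_C: "(\<lambda>x. f (rearrange n \<tau> x)) \<in> C" if "f \<in> RTrop (positions n)" "\<tau> permutes {1..n}" for f \<tau>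
    using C.comp_RTrop[OF that(1) rearrange_C[OF that(2)]] by simp
  define d where "d \<tau> x = (\<Sum>k\<in>{1..N}. \<bar>\<epsilon> k x - \<epsilon> k (rearrange n \<tau> x)\<bar>)" for \<tau> x
  have d_nonneg: "0 \<le> d \<tau> x" for \<tau> x
    by (simp add: d_def sum_nonneg)
  obtain L where L: "L \<ge> 0"
    "\<And>\<delta> x y. \<forall>p\<in>positions n. \<bar>x p - y p\<bar> \<le> \<delta> \<Longrightarrow> 0 \<le> \<delta> \<Longrightarrow> \<bar>r x - r y\<bar> \<le> L * \<delta>"
    using RTrop_lipschitz[OF assms(3)] unfolding sup_lipschitz_def by metis
  \<comment> \<open>\<open>K\<close> is a natural number so that multiplication by it stays within
    \<open>C\<close>.\<close>
  obtain K :: nat where K: "L * (8 * 9 ^ n) \<le> real K"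
    using real_arch_simple by blast
  have penalty: "r (rearrange n \<tau> x) - real K * d \<tau> x \<le> r x" for \<tau> x
  proof (rule field_le_epsilon)
    fix e :: real assume "0 < e"
    \<comment> \<open>Separation needs a positive error, but \<open>d \<tau> x\<close> may vanish.
      The slack costs at most \<open>e\<close> after multiplication by \<open>K\<close>, and the
      denominator is positive even for \<open>K = 0\<close>.\<close>
    define \<eta> where "\<eta> = d \<tau> x + e / (real K + 1)"
    have \<eta>: "0 < \<eta>"
      using d_nonneg[of \<tau> x] \<open>0 < e\<close> by (simp add: \<eta>_def add_nonneg_pos)
    have "\<bar>orbit_poly n (row_orbit n E) (rearrange n \<tau> x) - orbit_poly n (row_orbit n E) x\<bar> \<le> \<eta>"
      if E: "E \<in> binary_matrices n" for E
    proof -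
      obtain k where k: "k \<in> {1..N}" "orbit_poly n (row_orbit n E) = \<epsilon> k"
        using orbit_\<epsilon>[OF E] by blast
      have "\<bar>\<epsilon> k x - \<epsilon> k (rearrange n \<tau> x)\<bar> \<le> d \<tau> x"
        unfolding d_def
        by (rule member_le_sum[where f = "\<lambda>k. \<bar>\<epsilon> k x - \<epsilon> k (rearrange n \<tau> x)\<bar>"]) (use k in auto)
      also have "\<dots> \<le> \<eta>"
        using \<open>0 < e\<close> by (simp add: \<eta>_def)
      finally show ?thesis
        by (simp add: k abs_minus_commute)
    qed
    then obtain \<pi> where \<pi>: "\<pi> permutes {1..n}"
      "\<And>p. p \<in> positions n \<Longrightarrow> \<bar>rearrange n \<tau> x p - permute_rows \<pi> x p\<bar> \<le> 8 * 9 ^ n * \<eta>"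
      using orbit_polys_separate[OF _ \<eta>] by blast
    \<comment> \<open>By symmetry \<open>r x\<close> is the value at
      \<open>permute_rows \<pi> x\<close>, which is close to
      \<open>rearrange n \<tau> x\<close>.\<close>
    have "r (rearrange n \<tau> x) - r x \<le> L * (8 * 9 ^ n * \<eta>)"
      using L(2)[of "rearrange n \<tau> x" "permute_rows \<pi> x"] \<pi> \<eta> by (fastforce simp: sym)
    also have "\<dots> \<le> real K * \<eta>"
      using mult_right_mono[OF K] \<eta> by (simp add: mult.assoc)
    also have "\<dots> \<le> real K * d \<tau> x + e"
      using \<open>0 < e\<close> by (simp add: \<eta>_def field_simps)
    finally show "r (rearrange n \<tau> x) - real K * d \<tau> x \<le> r x + e"
      by simp
  qed
  have attained: "\<exists>\<tau>. \<tau> permutes {1..n} \<and> r (rearrange n \<tau> x) - real K * d \<tau> x = r x" for x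
  proof -
    obtain \<tau> \<sigma> where *: "\<tau> permutes {1..n}" "\<sigma> permutes {1..n}"
      "\<And>p. p \<in> positions n \<Longrightarrow> rearrange n \<tau> x p = permute_rows \<sigma> x p"
      by (rule ex_rearrange_eq) blast
    have eq: "f (rearrange n \<tau> x) = f (permute_rows \<sigma> x)" if "f \<in> RTrop (positions n)" for f
      using RTrop_cong[OF that *(3)] .
    have "r (rearrange n \<tau> x) = r x"
      by (simp add: eq[OF assms(3)] sym *(2))
    moreover have "d \<tau> x = 0"
      unfolding d_def by (intro sum.neutral ballI) (simp add: eq[OF \<epsilon>_RTrop] \<epsilon>_sym *(2))
    ultimately show ?thesis
      using *(1) by auto
  qed
  have "r = (\<lambda>x. Max ((\<lambda>\<tau>. r (rearrange n \<tau> x) - real K * d \<tau> x) ` {\<tau>. \<tau> permutes {1..n}}))"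
  proof
    fix x
    show "r x = Max ((\<lambda>\<tau>. r (rearrange n \<tau> x) - real K * d \<tau> x) ` {\<tau>. \<tau> permutes {1..n}})"
      using attained[of x] penalty[of _ x]
      by (intro Max_eqI[symmetric]) (auto simp: finite_permutations image_iff)
  qed
  also have "\<dots> \<in> C"
    unfolding d_def
    by (intro C.Max C.diff C.of_nat_mult C.sum C.abs comp_C \<epsilon>_C \<epsilon>_RTrop assms(3))
      (auto simp: finite_permutations intro: permutes_id)
  finally show ?thesis
    by (simp add: C_def)
qed

end
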